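(* Let $Q$ be an inverse quantal frame and let $X$ be a complete Hilbert $Q$-module with inner product $\langle-,-\rangle:X\times X\to Q$. Then for all $x,y\in X$ \[ \langle x,y\rangle=\bigvee_{u\in Q_{\mathcal I}} u\,\varsigma_X(u^*x\wedge y). \]
   Context: A sup-lattice is a complete lattice; sup-lattice homomorphisms preserve arbitrary joins; top elements are written $1$. A locale (frame) is a sup-lattice in which binary meets distribute over arbitrary joins. A unital involutive quantale $Q$ is a sup-lattice with an associative multiplication preserving arbitrary joins in each variable, a unit $e$, and a join-preserving involution $a\mapsto a^*$ with $a^{**}=a$, $(ab)^*=b^*a^*$. Put $Q_0=\{b\in Q: b\le e\}$ and $Q_{\mathcal I}=\{s\in Q: ss^*\vee s^*s\le e\}$ (the partial units). An inverse quantal frame is a unital involutive quantale $Q$ whose underlying lattice is a locale, such that $\bigvee Q_{\mathcal I}=1_Q$, and which has a (necessarily unique) stable support, i.e. a sup-lattice homomorphism $\varsigma_Q:Q\to Q_0$ with $\varsigma_Q(a)\le aa^*$, $a\le\varsigma_Q(a)a$ and $\varsigma_Q(ab)\le\varsigma_Q(a)$ for all $a,b\in Q$. A left $Q$-module is a sup-lattice $X$ with a unital associative left action of $Q$ preserving joins in each variable. A pre-Hilbert $Q$-module is a left $Q$-module $X$ with a map $\langle-,-\rangle:X\times X\to Q$ such that $\langle ax,y\rangle=a\langle x,y\rangle$, $\langle\bigvee_i x_i,y\rangle=\bigvee_i\langle x_i,y\rangle$ and $\langle x,y\rangle=\langle y,x\rangle^*$. It is complete if it has a Hilbert basis, i.e.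 a subset $\Gamma\subset X$ with $x=\bigvee_{t\in\Gamma}\langle x,t\rangle t$ for all $x\in X$ (the module is then automatically a Hilbert module, i.e. $\langle x,-\rangle=\langle y,-\rangle$ implies $x=y$; for $Q$ an inverse quantal frame it is also known that the underlying sup-lattice of $X$ is a locale). The support $\varsigma_X:X\to Q_0$ of $X$ is $\varsigma_X(x)=\langle x,x\rangle\wedge e=\langle x,1_X\rangle\wedge e$. *)

theory Defs
  imports Main
begin

text \<open>
  The unit \<open>e\<close> of a quantale is the monoid unit \<open>1\<close> of the class \<open>monoid_mult\<close>;
  the top element of a sup-lattice is \<open>top\<close>. Sup-lattices are rendered by the class
  \<open>complete_lattice\<close>. Preservation of empty joins (that is, of \<open>bot\<close>)
  is the instance of the empty set in the axioms below.
\<close>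

class unital_involutive_quantale = complete_lattice + monoid_mult +
  fixes star :: "'a \<Rightarrow> 'a"
  assumes Sup_mult: "Sup A * b = (SUP a\<in>A. a * b)"
    and mult_Sup: "a * Sup B = (SUP b\<in>B. a * b)"
    and star_Sup: "star (Sup A) = (SUP a\<in>A. star a)"
    and star_star: "star (star a) = a"
    and star_mult: "star (a * b) = star b * star a"
begin

definition partial_units :: "'a set" where
  "partial_units = {s. sup (s * star s) (star s * s) \<le> 1}"

text \<open>
  A stable support has codomain \<open>{b. b \<le> 1}\<close>, which is closed under joins of the quantale;
  hence it is a sup-lattice homomorphism iff it preserves joins computed in the quantale.
\<close>

definition stable_support :: "('a \<Rightarrow> 'a) \<Rightarrow> bool" where
  "stable_support \<sigma> \<longleftrightarrow>
     (\<forall>a. \<sigma> a \<le> 1) \<and>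
     (\<forall>A. \<sigma> (Sup A) = (SUP a\<in>A. \<sigma> a)) \<and>
     (\<forall>a. \<sigma> a \<le> a * star a) \<and>
     (\<forall>a. a \<le> \<sigma> a * a) \<and>
     (\<forall>a b. \<sigma> (a * b) \<le> \<sigma> a)"

end

class inverse_quantal_frame = unital_involutive_quantale +
  assumes inf_Sup_frame: "inf a (Sup B) = (SUP b\<in>B. inf a b)"
    and Sup_partial_units: "Sup partial_units = top"
    and ex_stable_support: "\<exists>\<sigma>. stable_support \<sigma>"

locale left_quantale_module =
  fixes act :: "'q::unital_involutive_quantale \<Rightarrow> 'x::complete_lattice \<Rightarrow> 'x" (infixr "\<cdot>" 75)
  assumes one_act: "1 \<cdot> x = x"
    and mult_act: "(a * b) \<cdot> x = a \<cdot> (b \<cdot> x)"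
    and Sup_act: "Sup A \<cdot> x = (SUP a\<in>A. a \<cdot> x)"
    and act_Sup: "a \<cdot> Sup Y = (SUP y\<in>Y. a \<cdot> y)"

locale pre_hilbert_module = left_quantale_module act
  for act :: "'q::unital_involutive_quantale \<Rightarrow> 'x::complete_lattice \<Rightarrow> 'x" (infixr "\<cdot>" 75) +
  fixes ip :: "'x \<Rightarrow> 'x \<Rightarrow> 'q"
  assumes ip_act: "ip (a \<cdot> x) y = a * ip x y"
    and ip_Sup: "ip (Sup Y) y = (SUP x\<in>Y. ip x y)"
    and ip_sym: "ip x y = star (ip y x)"
begin

definition hilbert_basis :: "'x set \<Rightarrow> bool" where
  "hilbert_basis \<Gamma> \<longleftrightarrow> (\<forall>x. x = (SUP t\<in>\<Gamma>. ip x t \<cdot> t))"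

end

locale hilbert_module = pre_hilbert_module +
  assumes nondegenerate: "ip x = ip y \<Longrightarrow> x = y"

text \<open>Completeness already implies nondegeneracy, so the latter is derived rather than assumed.\<close>

locale complete_hilbert_module = pre_hilbert_module +
  assumes ex_hilbert_basis: "\<exists>\<Gamma>. hilbert_basis \<Gamma>"

sublocale complete_hilbert_module \<subseteq> hilbert_module
proof
  fix x y assume "ip x = ip y"
  moreover obtain \<Gamma> where "hilbert_basis \<Gamma>" using ex_hilbert_basis by blast
  ultimately show "x = y" unfolding hilbert_basis_def by metis
qed

definition module_support ::
    "('x \<Rightarrow> 'x \<Rightarrow> 'q::unital_involutive_quantale) \<Rightarrow> 'x \<Rightarrow> 'q" where
  "module_support ip x = inf (ip x x) 1"

lemma module_support_eq_top:
  fixes act :: "'q::inverse_quantal_frame \<Rightarrow> 'x::complete_lattice \<Rightarrow> 'x"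
  assumes "complete_hilbert_module act ip"
  shows "module_support ip x = inf (ip x top) 1"
proof -
  interpret complete_hilbert_module act ip by fact
  have mult_mono_r: "a * b \<le> a * c" if "b \<le> c" for a b c :: 'q
    using mult_Sup[of a "{b, c}"] that by (simp add: sup.absorb2 sup.order_iff sup_commute)
  have mult_mono_l: "b * a \<le> c * a" if "b \<le> c" for a b c :: 'q
    using Sup_mult[of "{b, c}" a] that by (simp add: sup.absorb2 sup.order_iff sup_commute)
  have ip_mono_l: "ip y z \<le> ip y' z" if "y \<le> y'" for y y' z
    using ip_Sup[of "{y, y'}" z] that by (simp add: sup.absorb2 sup.order_iff sup_commute)
  have star_mono: "star a \<le> star b" if "a \<le> b" for a b :: 'q
    using star_Sup[of "{a, b}"] that by (simp add: sup.absorb2 sup.order_iff sup_commute)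
  have ip_mono_r: "ip z y \<le> ip z y'" if "y \<le> y'" for y y' z
    using star_mono[OF ip_mono_l[OF that, of z]] ip_sym by metis
  obtain \<sigma> :: "'q \<Rightarrow> 'q" where s: "stable_support \<sigma>" using ex_stable_support by blast
  have s1: "\<sigma> a \<le> 1" "\<sigma> (Sup A) = (SUP a\<in>A. \<sigma> a)" "\<sigma> a \<le> a * star a"
      "a \<le> \<sigma> a * a" "\<sigma> (a * b) \<le> \<sigma> a" for a b A
    using s by (auto simp: stable_support_def)
  have s_mono: "\<sigma> a \<le> \<sigma> b" if "a \<le> b" for a b
    using s1(2)[of "{a, b}"] that by (simp add: sup.absorb2 sup.order_iff sup_commute)
  obtain \<Gamma> where G: "hilbert_basis \<Gamma>" using ex_hilbert_basis by blast
  have expand: "ip x y = (SUP t\<in>\<Gamma>. ip x t * ip t y)" for y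
  proof -
    have "ip x y = ip (SUP t\<in>\<Gamma>. act (ip x t) t) y"
      using G unfolding hilbert_basis_def by metis
    then show ?thesis by (simp add: ip_Sup ip_act image_image)
  qed
  have le: "\<sigma> (ip x top) \<le> ip x x"
  proof -
    have "\<sigma> (ip x top) = (SUP t\<in>\<Gamma>. \<sigma> (ip x t * ip t top))"
      by (subst expand) (simp add: s1(2) image_image)
    also have "\<dots> \<le> (SUP t\<in>\<Gamma>. ip x t * ip t x)"
    proof (rule SUP_subset_mono[OF order_refl])
      fix t
      have "\<sigma> (ip x t * ip t top) \<le> \<sigma> (ip x t)" by (rule s1(5))
      also have "\<dots> \<le> ip x t * star (ip x t)" by (rule s1(3))
      also have "star (ip x t) = ip t x" using ip_sym by metis
      finally show "\<sigma> (ip x t * ip t top) \<le> ip x t * ip t x" .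
    qed
    also have "\<dots> = ip x x" using expand by metis
    finally show ?thesis .
  qed
  define b where "b = inf (ip x top) 1"
  have "b \<le> \<sigma> b * b" by (rule s1(4))
  also have "\<dots> \<le> \<sigma> b * 1" by (rule mult_mono_r) (simp add: b_def)
  also have "\<dots> = \<sigma> b" by simp
  also have "\<dots> \<le> \<sigma> (ip x top)" by (rule s_mono) (simp add: b_def)
  also have "\<dots> \<le> ip x x" by (rule le)
  finally have "b \<le> ip x x" .
  moreover have "ip x x \<le> ip x top" by (rule ip_mono_r) simp
  ultimately show ?thesis
    unfolding module_support_def b_def
    by (meson inf.cobounded2 inf_greatest inf_mono order_antisym order_refl)
qed

end

theory Submission
  imports Defs
begin

text \<open>
  Write \<open>\<sigma>\<close> for the stable support of \<open>Q\<close>. That every term of the join lies below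
  \<open>ip x y\<close> is immediate: the support of \<open>inf (star u \<cdot> x) y\<close> is at most
  \<open>ip (star u \<cdot> x) y = star u * ip x y\<close>, and \<open>u * star u \<le> 1\<close>.

  For the converse, the partial units cover \<open>Q\<close>, which is a frame, so \<open>ip x y\<close> is the join of
  the elements \<open>a = inf (ip x y) u\<close> with \<open>u\<close> a partial unit. The support gives
  \<open>a \<le> a * star a * a \<le> u * (star a * a)\<close>, and \<open>star a * a\<close> is at most both \<open>1\<close> and
  \<open>ip (star u \<cdot> x) y\<close>. It remains to prove the key inequality
  \<open>inf (ip z y) 1 \<le> module_support ip (inf z y)\<close> (\<open>ip_inf_one_le_module_support\<close>).

  Expanding \<open>ip z y\<close> along a Hilbert basis and then covering \<open>ip z t\<close> by partial units reduces
  the key inequality to elements \<open>c \<le> 1\<close> with \<open>c \<le> s * ip t y\<close>, where \<open>s\<close> is a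
  partial unit below \<open>ip z t\<close> and \<open>t\<close> is a basis element. Put \<open>w = (c * s) \<cdot> t\<close>. Since
  \<open>c * s\<close> is below both \<open>ip z t\<close> and \<open>ip y t\<close>, the element \<open>w\<close> lies below both \<open>z\<close>
  and \<open>y\<close>. Stability of the support, together with \<open>\<sigma> (ip t y) \<le> ip t t\<close>, then yields
  \<open>c \<le> ip w w\<close>.
\<close>

section \<open>Quantales with a stable support\<close>

lemma quantale_mult_mono:
  fixes a b c d :: "'q::unital_involutive_quantale"
  assumes "a \<le> b" "c \<le> d"
  shows "a * c \<le> b * d"
proof -
  have "a * c \<le> b * c"
    using Sup_mult[of "{a, b}" c] assms(1) by (simp add: sup.absorb2 sup.order_iff sup_commute)
  also have "b * c \<le> b * d"
    using mult_Sup[of b "{c, d}"] assms(2) by (simp add: sup.absorb2 sup.order_iff sup_commute)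
  finally show ?thesis .
qed

lemma star_mono:
  fixes a b :: "'q::unital_involutive_quantale"
  assumes "a \<le> b"
  shows "star a \<le> star b"
  using star_Sup[of "{a, b}"] assms by (simp add: sup.absorb2 sup.order_iff sup_commute)

lemma star_one: "star (1 :: 'q::unital_involutive_quantale) = 1"
  by (metis mult_1_left mult_1_right star_mult star_star)

lemma partial_unitsD:
  assumes "u \<in> partial_units"
  shows "u * star u \<le> 1" "star u * u \<le> 1"
  using assms by (auto simp: partial_units_def)

lemma partial_units_downward_closed:
  assumes "u \<in> partial_units" "s \<le> u"
  shows "s \<in> partial_units"
proof -
  have "s * star s \<le> u * star u" "star s * s \<le> star u * u"
    by (intro quantale_mult_mono star_mono assms(2))+
  with partial_unitsD[OF assms(1)] show ?thesis
    unfolding partial_units_def by (auto intro: order_trans)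
qed

lemma stable_support_mono:
  assumes "stable_support \<sigma>" "a \<le> b"
  shows "\<sigma> a \<le> \<sigma> b"
proof -
  have "\<sigma> (Sup {a, b}) = (SUP c\<in>{a, b}. \<sigma> c)"
    using assms(1) unfolding stable_support_def by blast
  with assms(2) show ?thesis
    by (simp add: sup.absorb2 sup.order_iff sup_commute)
qed

lemma le_mult_star_mult:
  fixes \<sigma> :: "'q::unital_involutive_quantale \<Rightarrow> 'q"
    and a :: 'q
  assumes "stable_support \<sigma>"
  shows "a \<le> a * star a * a"
proof -
  have "a \<le> \<sigma> a * a" and "\<sigma> a \<le> a * star a"
    using assms by (auto simp: stable_support_def)
  then show ?thesis
    by (meson order_refl order_trans quantale_mult_mono)
qed

lemma le_one_self_adjoint_idempotent:
  fixes \<sigma> :: "'q::unital_involutive_quantale \<Rightarrow> 'q"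
    and c :: 'q
  assumes "stable_support \<sigma>" "c \<le> 1"
  shows "c \<le> \<sigma> c" "star c = c" "c * c = c"
proof -
  have st: "star c \<le> 1"
    using star_mono[OF assms(2)] by (simp add: star_one)
  have "c \<le> \<sigma> c * c"
    using assms(1) by (auto simp: stable_support_def)
  also have "\<dots> \<le> \<sigma> c"
    using quantale_mult_mono[OF order_refl assms(2), of "\<sigma> c"] by simp
  finally show "c \<le> \<sigma> c" .
  have "c \<le> c * star c"
    using \<open>c \<le> \<sigma> c\<close> assms(1) unfolding stable_support_def by (meson order_trans)
  moreover have "c * star c \<le> c"
    using quantale_mult_mono[OF order_refl st, of c] by simp
  ultimately have eq: "c * star c = c" by simp
  then show star: "star c = c"
    by (metis star_mult star_star)
  show "c * c = c"
    using eq star by simp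
qed

lemma eq_Sup_inf_partial_units:
  fixes a :: "'q::inverse_quantal_frame"
  shows "a = (SUP u\<in>partial_units. inf a u)"
  using inf_Sup_frame[of a partial_units] by (simp add: Sup_partial_units)

section \<open>Inner products and supports\<close>

context pre_hilbert_module
begin

lemma act_mono_left: "a \<le> b \<Longrightarrow> a \<cdot> x \<le> b \<cdot> x"
  using Sup_act[of "{a, b}" x] by (simp add: sup.absorb2 sup.order_iff sup_commute)

lemma ip_mono_left: "x \<le> x' \<Longrightarrow> ip x y \<le> ip x' y"
  using ip_Sup[of "{x, x'}" y] by (simp add: sup.absorb2 sup.order_iff sup_commute)

lemma ip_mono: "x \<le> x' \<Longrightarrow> y \<le> y' \<Longrightarrow> ip x y \<le> ip x' y'"
  by (metis ip_mono_left ip_sym order_trans star_mono)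

lemma ip_act_right: "ip x (a \<cdot> y) = ip x y * star a"
  by (metis ip_act ip_sym star_mult)

lemma ip_hilbert_basis_expansion:
  assumes "hilbert_basis \<Gamma>"
  shows "ip x y = (SUP t\<in>\<Gamma>. ip x t * ip t y)"
proof -
  have "ip x y = ip (SUP t\<in>\<Gamma>. ip x t \<cdot> t) y"
    using assms unfolding hilbert_basis_def by metis
  then show ?thesis
    by (simp add: ip_Sup ip_act image_image)
qed

lemma act_basis_le:
  assumes "hilbert_basis \<Gamma>" "t \<in> \<Gamma>" "a \<le> ip x t"
  shows "a \<cdot> t \<le> x"
proof -
  have "a \<cdot> t \<le> ip x t \<cdot> t"
    by (rule act_mono_left[OF assms(3)])
  also have "\<dots> \<le> (SUP t\<in>\<Gamma>. ip x t \<cdot> t)"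
    using assms(2) by (rule SUP_upper)
  also have "\<dots> = x"
    using assms(1) unfolding hilbert_basis_def by metis
  finally show ?thesis .
qed

lemma stable_support_ip_le:
  fixes \<sigma> :: "'q \<Rightarrow> 'q"
  assumes "hilbert_basis \<Gamma>" and \<sigma>: "stable_support \<sigma>"
  shows "\<sigma> (ip x y) \<le> ip x x"
proof -
  have "\<sigma> (ip x y) = \<sigma> (SUP t\<in>\<Gamma>. ip x t * ip t y)"
    by (simp flip: ip_hilbert_basis_expansion[OF assms(1)])
  also have "\<dots> = (SUP t\<in>\<Gamma>. \<sigma> (ip x t * ip t y))"
    using \<sigma> by (simp add: stable_support_def image_image)
  also have "\<dots> \<le> (SUP t\<in>\<Gamma>. ip x t * ip t x)"
  proof (rule SUP_mono')
    fix t
    have "\<sigma> (ip x t * ip t y) \<le> ip x t * star (ip x t)"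
      using \<sigma> unfolding stable_support_def by (meson order_trans)
    then show "\<sigma> (ip x t * ip t y) \<le> ip x t * ip t x"
      by (metis ip_sym)
  qed
  also have "\<dots> = ip x x"
    by (rule ip_hilbert_basis_expansion[OF assms(1), symmetric])
  finally show ?thesis .
qed

text \<open>
  The local form of the key inequality. No regularity of the basis element \<open>t\<close> is needed:
  the factor \<open>ip t t\<close> in the inner square of \<open>(c * s) \<cdot> t\<close> is bounded below by
  \<open>\<sigma> (ip t y)\<close>.
\<close>

lemma le_ip_inf:
  fixes \<sigma> :: "'q \<Rightarrow> 'q"
  assumes \<Gamma>: "hilbert_basis \<Gamma>" "t \<in> \<Gamma>" and \<sigma>: "stable_support \<sigma>"
    and s: "s \<in> partial_units" "s \<le> ip z t"
    and c: "c \<le> 1" "c \<le> s * ip t y"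
  shows "c \<le> ip (inf z y) (inf z y)"
proof -
  define q where "q = ip t y"
  define w where "w = (c * s) \<cdot> t"
  note c_proj = le_one_self_adjoint_idempotent[OF \<sigma> c(1)]
  have "c * s \<le> s"
    using quantale_mult_mono[OF c(1) order_refl, of s] by simp
  then have "w \<le> z"
    unfolding w_def using s(2) by (intro act_basis_le[OF \<Gamma>]) (rule order_trans)
  have "star s * c \<le> star s * s * q"
    using quantale_mult_mono[OF order_refl c(2), of "star s"] by (simp add: q_def mult.assoc)
  also have "\<dots> \<le> q"
    using quantale_mult_mono[OF partial_unitsD(2)[OF s(1)] order_refl, of q] by simp
  finally have "star (star s * c) \<le> star q"
    by (rule star_mono)
  then have "c * s \<le> ip y t"
    by (metis c_proj(2) ip_sym q_def star_mult star_star)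
  then have "w \<le> y"
    unfolding w_def by (rule act_basis_le[OF \<Gamma>])
  have \<sigma>q: "\<sigma> q * star (\<sigma> q) \<le> ip t t"
  proof -
    have "\<sigma> q \<le> 1" using \<sigma> by (simp add: stable_support_def)
    then have "\<sigma> q * star (\<sigma> q) = \<sigma> q"
      by (simp add: le_one_self_adjoint_idempotent[OF \<sigma>])
    also have "\<dots> \<le> ip t t"
      unfolding q_def by (rule stable_support_ip_le[OF \<Gamma>(1) \<sigma>])
    finally show ?thesis .
  qed
  have "c = c * c" by (simp add: c_proj)
  also have "\<dots> \<le> c * (s * q)"
    using c(2) by (intro quantale_mult_mono) (simp_all add: q_def)
  also have "\<dots> \<le> c * (s * (\<sigma> q * q))"
    using \<sigma> by (intro quantale_mult_mono order_refl) (simp add: stable_support_def)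
  finally have "c \<le> (c * s * \<sigma> q) * q" by (simp add: mult.assoc)
  then have "\<sigma> c \<le> \<sigma> ((c * s * \<sigma> q) * q)"
    by (rule stable_support_mono[OF \<sigma>])
  \<comment> \<open>Stability discards the right factor \<open>q\<close>.\<close>
  also have "\<dots> \<le> (c * s * \<sigma> q) * star (c * s * \<sigma> q)"
    using \<sigma> unfolding stable_support_def by (meson order_trans)
  also have "\<dots> = (c * s) * (\<sigma> q * star (\<sigma> q)) * star (c * s)"
    by (simp add: star_mult mult.assoc)
  also have "\<dots> \<le> (c * s) * ip t t * star (c * s)"
    by (intro quantale_mult_mono order_refl \<sigma>q)
  also have "\<dots> = ip w w"
    by (simp add: w_def ip_act ip_act_right mult.assoc)
  also have "\<dots> \<le> ip (inf z y) (inf z y)"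
    using \<open>w \<le> z\<close> \<open>w \<le> y\<close> by (intro ip_mono) simp_all
  finally show ?thesis
    using c_proj(1) by (rule order_trans[rotated])
qed

end

lemma ip_inf_one_le_module_support:
  fixes act :: "'q::inverse_quantal_frame \<Rightarrow> 'x::complete_lattice \<Rightarrow> 'x"
  assumes "complete_hilbert_module act ip"
  shows "inf (ip z y) 1 \<le> module_support ip (inf z y)"
proof -
  interpret complete_hilbert_module act ip by fact
  obtain \<sigma> :: "'q \<Rightarrow> 'q" where \<sigma>: "stable_support \<sigma>"
    using ex_stable_support by blast
  obtain \<Gamma> where \<Gamma>: "hilbert_basis \<Gamma>"
    using ex_hilbert_basis by blast
  have local_bound: "inf 1 (inf (ip z t) u * ip t y) \<le> ip (inf z y) (inf z y)"
    if "t \<in> \<Gamma>" "u \<in> partial_units" for t u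
    using partial_units_downward_closed[OF that(2), of "inf (ip z t) u"]
    by (intro le_ip_inf[OF \<Gamma> that(1) \<sigma>, of "inf (ip z t) u"]) simp_all
  have term_bound: "inf 1 (ip z t * ip t y) \<le> ip (inf z y) (inf z y)" if "t \<in> \<Gamma>" for t
  proof -
    have "ip z t * ip t y = (SUP u\<in>partial_units. inf (ip z t) u) * ip t y"
      by (simp flip: eq_Sup_inf_partial_units)
    also have "\<dots> = (SUP u\<in>partial_units. inf (ip z t) u * ip t y)"
      by (simp add: Sup_mult image_image)
    finally show ?thesis
      by (auto simp: inf_Sup_frame image_image intro!: SUP_least local_bound that)
  qed
  have "inf 1 (ip z y) = (SUP t\<in>\<Gamma>. inf 1 (ip z t * ip t y))"
    by (simp add: ip_hilbert_basis_expansion[OF \<Gamma>, of z y] inf_Sup_frame image_image)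
  also have "\<dots> \<le> ip (inf z y) (inf z y)"
    by (rule SUP_least) (rule term_bound)
  finally show ?thesis
    by (simp add: module_support_def inf_commute)
qed

section \<open>The inner product as a join over the partial units\<close>

theorem theorem3p6:
  fixes act :: "'q::inverse_quantal_frame \<Rightarrow> 'x::complete_lattice \<Rightarrow> 'x"
    and ip :: "'x \<Rightarrow> 'x \<Rightarrow> 'q"
    and x y :: 'x
  assumes "complete_hilbert_module act ip"
  shows "ip x y =
    (SUP u\<in>partial_units. u * module_support ip (inf (act (star u) x) y))"
proof (rule antisym)
  interpret complete_hilbert_module act ip by fact
  obtain \<sigma> :: "'q \<Rightarrow> 'q" where \<sigma>: "stable_support \<sigma>"
    using ex_stable_support by blast
  show "ip x y \<le> (SUP u\<in>partial_units. u * module_support ip (inf (act (star u) x) y))"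
  proof (subst eq_Sup_inf_partial_units, rule SUP_mono)
    fix u :: 'q assume u: "u \<in> partial_units"
    define a where "a = inf (ip x y) u"
    have "a \<le> u" "a \<le> ip x y" by (simp_all add: a_def)
    have "star a * a \<le> 1"
      using u \<open>a \<le> u\<close> by (intro partial_unitsD(2)) (rule partial_units_downward_closed)
    moreover have "star a * a \<le> ip (act (star u) x) y"
      unfolding ip_act using \<open>a \<le> u\<close> \<open>a \<le> ip x y\<close> by (intro quantale_mult_mono star_mono)
    ultimately have "star a * a \<le> inf (ip (act (star u) x) y) 1"
      by simp
    also have "\<dots> \<le> module_support ip (inf (act (star u) x) y)"
      by (rule ip_inf_one_le_module_support[OF assms])
    finally have "a * (star a * a) \<le> u * module_support ip (inf (act (star u) x) y)"
      by (rule quantale_mult_mono[OF \<open>a \<le> u\<close>])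
    then have "a \<le> u * module_support ip (inf (act (star u) x) y)"
      using le_mult_star_mult[OF \<sigma>, of a] by (simp add: mult.assoc)
    then show "\<exists>v\<in>partial_units. inf (ip x y) u \<le> v * module_support ip (inf (act (star v) x) y)"
      unfolding a_def using u by blast
  qed
  show "(SUP u\<in>partial_units. u * module_support ip (inf (act (star u) x) y)) \<le> ip x y"
  proof (rule SUP_least)
    fix u :: 'q assume u: "u \<in> partial_units"
    have "module_support ip (inf (act (star u) x) y) \<le> ip (act (star u) x) y"
      unfolding module_support_def by (rule le_infI1) (simp add: ip_mono)
    then have "u * module_support ip (inf (act (star u) x) y) \<le> u * (star u * ip x y)"
      unfolding ip_act by (rule quantale_mult_mono[OF order_refl])
    also have "\<dots> \<le> ip x y"
      using quantale_mult_mono[OF partial_unitsD(1)[OF u] order_refl, of "ip x y"]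
      by (simp add: mult.assoc)
    finally show "u * module_support ip (inf (act (star u) x) y) \<le> ip x y" .
  qed
qed

end
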